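(* Let $R$ be a prime ring which is semilocal or left qfd, and let $M$ be a faithful $*$-prime left $R$-module with non-zero socle. Then $\mathrm{End}_R(M)$ is a prime ring.
   Context: Rings are associative and unital. Homomorphisms of left modules are written on the right of their arguments. For submodules $N,L$ of $M$ put $N*L = N\,\mathrm{Hom}_R(M,L)=\sum\{(N)f \mid f\in \mathrm{Hom}_R(M,L)\}$. $M$ is called $*$-prime if $N*L\neq 0$ for all non-zero submodules $N,L$ of $M$. A ring $R$ is left quotient finite dimensional (qfd) if every cyclic left $R$-module has finite Goldie (uniform) dimension. $R$ is semilocal if $R$ modulo its Jacobson radical is semisimple artinian. *)

theory Defs
  imports "HOL-Algebra.Module" "HOL-Algebra.QuotRing" "HOL-Algebra.Ideal_Product"
begin

section \<open>Modules over rings that need not be commutative\<close>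

text \<open>
  The library locale \<^locale>\<open>module\<close> requires a commutative ring of scalars.  The following one has
  the same axioms over an arbitrary unital ring; the record type of modules and the predicate
  \<^const>\<open>submodule\<close> are those of the library.
\<close>

locale left_module = R?: ring R + M?: abelian_group M
  for R :: "('a, 'r) ring_scheme" (structure)
  and M :: "('a, 'b, 'm) module_scheme" (structure) +
  assumes smult_closed [simp, intro]:
      "\<lbrakk>a \<in> carrier R; x \<in> carrier M\<rbrakk> \<Longrightarrow> a \<odot>\<^bsub>M\<^esub> x \<in> carrier M"
    and smult_l_distr:
      "\<lbrakk>a \<in> carrier R; b \<in> carrier R; x \<in> carrier M\<rbrakk> \<Longrightarrow>
       (a \<oplus>\<^bsub>R\<^esub> b) \<odot>\<^bsub>M\<^esub> x = a \<odot>\<^bsub>M\<^esub> x \<oplus>\<^bsub>M\<^esub> b \<odot>\<^bsub>M\<^esub> x"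
    and smult_r_distr:
      "\<lbrakk>a \<in> carrier R; x \<in> carrier M; y \<in> carrier M\<rbrakk> \<Longrightarrow>
       a \<odot>\<^bsub>M\<^esub> (x \<oplus>\<^bsub>M\<^esub> y) = a \<odot>\<^bsub>M\<^esub> x \<oplus>\<^bsub>M\<^esub> a \<odot>\<^bsub>M\<^esub> y"
    and smult_assoc1:
      "\<lbrakk>a \<in> carrier R; b \<in> carrier R; x \<in> carrier M\<rbrakk> \<Longrightarrow>
       (a \<otimes>\<^bsub>R\<^esub> b) \<odot>\<^bsub>M\<^esub> x = a \<odot>\<^bsub>M\<^esub> (b \<odot>\<^bsub>M\<^esub> x)"
    and smult_one [simp]:
      "x \<in> carrier M \<Longrightarrow> \<one>\<^bsub>R\<^esub> \<odot>\<^bsub>M\<^esub> x = x"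

definition sum_submodules ::
  "('a, 'r) ring_scheme \<Rightarrow> ('a, 'b, 'm) module_scheme \<Rightarrow> 'b set set \<Rightarrow> 'b set" where
  "sum_submodules R M F = \<Inter> {K. submodule K R M \<and> \<Union> F \<subseteq> K}"

text \<open>Homomorphisms are extensional functions, so that equality of homomorphisms is equality in HOL.\<close>

definition module_homs ::
  "('a, 'r) ring_scheme \<Rightarrow> ('a, 'b, 'm) module_scheme \<Rightarrow> ('a, 'c, 'n) module_scheme
    \<Rightarrow> ('b \<Rightarrow> 'c) set" where
  "module_homs R M N =
     {f \<in> carrier M \<rightarrow>\<^sub>E carrier N.
        (\<forall>x \<in> carrier M. \<forall>y \<in> carrier M. f (x \<oplus>\<^bsub>M\<^esub> y) = f x \<oplus>\<^bsub>N\<^esub> f y) \<and>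
        (\<forall>r \<in> carrier R. \<forall>x \<in> carrier M. f (r \<odot>\<^bsub>M\<^esub> x) = r \<odot>\<^bsub>N\<^esub> f x)}"

text \<open>
  Homomorphisms act on the right: the product \<open>f g\<close> in the endomorphism ring first applies \<open>f\<close>,
  then \<open>g\<close>.
\<close>

definition endo_ring ::
  "('a, 'r) ring_scheme \<Rightarrow> ('a, 'b, 'm) module_scheme \<Rightarrow> ('b \<Rightarrow> 'b) ring" where
  "endo_ring R M =
     \<lparr>carrier = module_homs R M M,
      monoid.mult = (\<lambda>f g. \<lambda>x \<in> carrier M. g (f x)),
      one = (\<lambda>x \<in> carrier M. x),
      zero = (\<lambda>x \<in> carrier M. \<zero>\<^bsub>M\<^esub>),
      add = (\<lambda>f g. \<lambda>x \<in> carrier M. f x \<oplus>\<^bsub>M\<^esub> g x)\<rparr>"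

definition faithful_module ::
  "('a, 'r) ring_scheme \<Rightarrow> ('a, 'b, 'm) module_scheme \<Rightarrow> bool" where
  "faithful_module R M \<longleftrightarrow>
     (\<forall>r \<in> carrier R. (\<forall>x \<in> carrier M. r \<odot>\<^bsub>M\<^esub> x = \<zero>\<^bsub>M\<^esub>) \<longrightarrow> r = \<zero>\<^bsub>R\<^esub>)"

definition cyclic_module ::
  "('a, 'r) ring_scheme \<Rightarrow> ('a, 'b, 'm) module_scheme \<Rightarrow> bool" where
  "cyclic_module R M \<longleftrightarrow> (\<exists>x \<in> carrier M. carrier M = {r \<odot>\<^bsub>M\<^esub> x | r. r \<in> carrier R})"

definition simple_submodule ::
  "('a, 'r) ring_scheme \<Rightarrow> ('a, 'b, 'm) module_scheme \<Rightarrow> 'b set \<Rightarrow> bool" where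
  "simple_submodule R M S \<longleftrightarrow>
     submodule S R M \<and> S \<noteq> {\<zero>\<^bsub>M\<^esub>} \<and>
     (\<forall>K. submodule K R M \<and> K \<subseteq> S \<longrightarrow> K = {\<zero>\<^bsub>M\<^esub>} \<or> K = S)"

definition socle :: "('a, 'r) ring_scheme \<Rightarrow> ('a, 'b, 'm) module_scheme \<Rightarrow> 'b set" where
  "socle R M = sum_submodules R M {S. simple_submodule R M S}"

text \<open>A module has finite Goldie dimension if it contains no infinite direct sum of non-zero
  submodules.\<close>

definition finite_goldie_dim ::
  "('a, 'r) ring_scheme \<Rightarrow> ('a, 'b, 'm) module_scheme \<Rightarrow> bool" where
  "finite_goldie_dim R M \<longleftrightarrow>
     \<not> (\<exists>N :: nat \<Rightarrow> 'b set.
          (\<forall>i. submodule (N i) R M \<and> N i \<noteq> {\<zero>\<^bsub>M\<^esub>}) \<and>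
          (\<forall>i. N i \<inter> sum_submodules R M {N j | j. j \<noteq> i} = {\<zero>\<^bsub>M\<^esub>}))"

section \<open>Star-prime modules\<close>

definition star_prod ::
  "('a, 'r) ring_scheme \<Rightarrow> ('a, 'b, 'm) module_scheme \<Rightarrow> 'b set \<Rightarrow> 'b set \<Rightarrow> 'b set" where
  "star_prod R M N L =
     sum_submodules R M {f ` N | f. f \<in> module_homs R M (M\<lparr>carrier := L\<rparr>)}"

definition star_prime :: "('a, 'r) ring_scheme \<Rightarrow> ('a, 'b, 'm) module_scheme \<Rightarrow> bool" where
  "star_prime R M \<longleftrightarrow>
     (\<forall>N L. submodule N R M \<and> submodule L R M \<and> N \<noteq> {\<zero>\<^bsub>M\<^esub>} \<and> L \<noteq> {\<zero>\<^bsub>M\<^esub>}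
        \<longrightarrow> star_prod R M N L \<noteq> {\<zero>\<^bsub>M\<^esub>})"

section \<open>Classes of rings\<close>

definition prime_ring :: "('a, 'r) ring_scheme \<Rightarrow> bool" where
  "prime_ring R \<longleftrightarrow>
     ring R \<and> \<one>\<^bsub>R\<^esub> \<noteq> \<zero>\<^bsub>R\<^esub> \<and>
     (\<forall>I J. ideal I R \<and> ideal J R \<and> ideal_prod R I J = {\<zero>\<^bsub>R\<^esub>}
        \<longrightarrow> I = {\<zero>\<^bsub>R\<^esub>} \<or> J = {\<zero>\<^bsub>R\<^esub>})"

text \<open>The multiplication and the unit in the record of a module are irrelevant.\<close>

definition regular_module :: "('a, 'r) ring_scheme \<Rightarrow> ('a, 'a) module" where
  "regular_module R =
     \<lparr>carrier = carrier R, monoid.mult = monoid.mult R, one = one R, zero = zero R, add = add R,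
      smult = monoid.mult R\<rparr>"

definition left_ideal :: "('a, 'r) ring_scheme \<Rightarrow> 'a set \<Rightarrow> bool" where
  "left_ideal R I \<longleftrightarrow> submodule I R (regular_module R)"

definition maximal_left_ideal :: "('a, 'r) ring_scheme \<Rightarrow> 'a set \<Rightarrow> bool" where
  "maximal_left_ideal R I \<longleftrightarrow>
     left_ideal R I \<and> I \<noteq> carrier R \<and>
     (\<forall>J. left_ideal R J \<and> I \<subseteq> J \<longrightarrow> J = I \<or> J = carrier R)"

definition jacobson_radical :: "('a, 'r) ring_scheme \<Rightarrow> 'a set" where
  "jacobson_radical R = carrier R \<inter> \<Inter> {I. maximal_left_ideal R I}"

definition left_artinian :: "('a, 'r) ring_scheme \<Rightarrow> bool" where
  "left_artinian R \<longleftrightarrow>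
     (\<forall>I :: nat \<Rightarrow> 'a set. (\<forall>n. left_ideal R (I n) \<and> I (Suc n) \<subseteq> I n)
        \<longrightarrow> (\<exists>n. \<forall>m \<ge> n. I m = I n))"

text \<open>Semisimplicity means that the regular module is a sum of simple submodules.\<close>

definition semisimple_artinian :: "('a, 'r) ring_scheme \<Rightarrow> bool" where
  "semisimple_artinian R \<longleftrightarrow>
     ring R \<and> socle R (regular_module R) = carrier R \<and> left_artinian R"

definition semilocal :: "('a, 'r) ring_scheme \<Rightarrow> bool" where
  "semilocal R \<longleftrightarrow> semisimple_artinian (R Quot jacobson_radical R)"

text \<open>
  Every cyclic left module over \<open>R\<close> is isomorphic to some \<open>R/I\<close> with \<open>I\<close> a left ideal, whose
  elements are cosets, that is, subsets of \<open>R\<close>.  Quantifying over the modules with elements of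
  type \<open>'a set\<close> therefore covers all cyclic modules up to isomorphism.
\<close>

definition left_qfd :: "('a, 'r) ring_scheme \<Rightarrow> bool" where
  "left_qfd R \<longleftrightarrow>
     (\<forall>N :: ('a, 'a set) module.
        left_module R N \<and> cyclic_module R N \<longrightarrow> finite_goldie_dim R N)"

end

theory Submission
  imports Defs
begin

text \<open>
  Let \<open>S\<close> be a simple submodule.  Star-primeness with \<open>N = R x\<close> shows that \<open>M\<close> is cogenerated by each of
  its non-zero submodules; with \<open>N = S\<close> it shows that every non-zero submodule contains a homomorphic
  image of \<open>S\<close>, so the socle is essential.  The point is that \<open>M\<close> equals its socle.
  If \<open>R\<close> is semilocal, the Jacobson radical kills \<open>S\<close>, hence \<open>M\<close>, and \<open>M\<close> is a module over a semisimple
  ring.  If \<open>R\<close> is left qfd, a simple \<open>T \<subseteq> C \<subseteq> R m\<close> and \<open>f : M \<rightarrow> T\<close> non-zero on \<open>T\<close> give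
  \<open>C = T \<oplus> (C \<inter> ker f)\<close>; if \<open>R m\<close> is not in the socle, this splitting can be repeated forever and yields
  an infinite direct sum in \<open>R m\<close>.
  Finally, for non-zero endomorphisms \<open>f\<close>, \<open>g\<close> the map \<open>g\<close> is injective on some simple \<open>T\<close>, and a map
  \<open>h : M \<rightarrow> T\<close> that does not kill the image of \<open>f\<close> gives \<open>f h g \<noteq> 0\<close>.
\<close>

section \<open>Left modules and their submodules\<close>

text \<open>Left ideals are by definition submodules of \<open>regular_module R\<close>, so this
  brings all submodule lemmas to bear on them; it is also applied to a quotient ring.\<close>

lemma (in ring) left_module_regular: "left_module R (regular_module R)"
proof -
  have "abelian_group (regular_module R)"
  proof (rule abelian_groupI)
    fix x assume "x \<in> carrier (regular_module R)"
    then show "\<exists>y\<in>carrier (regular_module R). y \<oplus>\<^bsub>regular_module R\<^esub> x = \<zero>\<^bsub>regular_module R\<^esub>"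
      by (intro bexI[of _ "\<ominus> x"]) (auto simp: regular_module_def l_neg)
  qed (auto simp: regular_module_def a_ac)
  then show ?thesis
    by (intro left_module.intro left_module_axioms.intro)
      (auto simp: regular_module_def l_distr r_distr m_assoc ring_axioms)
qed

context left_module
begin

lemma smult_l_zero [simp]:
  assumes "x \<in> carrier M" shows "\<zero> \<odot>\<^bsub>M\<^esub> x = \<zero>\<^bsub>M\<^esub>"
proof -
  have "\<zero> \<odot>\<^bsub>M\<^esub> x \<oplus>\<^bsub>M\<^esub> \<zero> \<odot>\<^bsub>M\<^esub> x = \<zero> \<odot>\<^bsub>M\<^esub> x"
    using smult_l_distr[of \<zero> \<zero> x] assms by simp
  then show ?thesis using assms by (metis M.add.r_cancel_one' R.zero_closed smult_closed)
qed

lemma smult_r_zero [simp]: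
  assumes "r \<in> carrier R" shows "r \<odot>\<^bsub>M\<^esub> \<zero>\<^bsub>M\<^esub> = \<zero>\<^bsub>M\<^esub>"
  by (metis M.zero_closed R.zero_closed R.r_null assms smult_assoc1 smult_l_zero)

lemma smult_uminus_one:
  assumes "x \<in> carrier M" shows "(\<ominus> \<one>) \<odot>\<^bsub>M\<^esub> x = \<ominus>\<^bsub>M\<^esub> x"
proof -
  have "(\<ominus> \<one>) \<odot>\<^bsub>M\<^esub> x \<oplus>\<^bsub>M\<^esub> x = \<zero>\<^bsub>M\<^esub>"
    using smult_l_distr[of "\<ominus> \<one>" \<one> x] assms by (simp add: R.l_neg)
  then show ?thesis using assms by (simp add: M.minus_equality)
qed

text \<open>The library predicate also demands closure under negatives; that comes from the scalar
  -1, so the four closure conditions suffice.\<close>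

lemma submodule_iff:
  "submodule H R M \<longleftrightarrow> H \<subseteq> carrier M \<and> \<zero>\<^bsub>M\<^esub> \<in> H \<and> (\<forall>x\<in>H. \<forall>y\<in>H. x \<oplus>\<^bsub>M\<^esub> y \<in> H) \<and>
     (\<forall>r\<in>carrier R. \<forall>x\<in>H. r \<odot>\<^bsub>M\<^esub> x \<in> H)"
proof
  assume "submodule H R M"
  then interpret H: submodule H R M .
  show "H \<subseteq> carrier M \<and> \<zero>\<^bsub>M\<^esub> \<in> H \<and> (\<forall>x\<in>H. \<forall>y\<in>H. x \<oplus>\<^bsub>M\<^esub> y \<in> H) \<and>
     (\<forall>r\<in>carrier R. \<forall>x\<in>H. r \<odot>\<^bsub>M\<^esub> x \<in> H)"
    using H.subset H.one_closed H.m_closed H.smult_closed by auto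
next
  assume H: "H \<subseteq> carrier M \<and> \<zero>\<^bsub>M\<^esub> \<in> H \<and> (\<forall>x\<in>H. \<forall>y\<in>H. x \<oplus>\<^bsub>M\<^esub> y \<in> H) \<and>
     (\<forall>r\<in>carrier R. \<forall>x\<in>H. r \<odot>\<^bsub>M\<^esub> x \<in> H)"
  have "inv\<^bsub>add_monoid M\<^esub> x \<in> H" if "x \<in> H" for x
  proof -
    have "(\<ominus> \<one>) \<odot>\<^bsub>M\<^esub> x \<in> H" using H that by blast
    moreover have "x \<in> carrier M" using H that by blast
    ultimately have "\<ominus>\<^bsub>M\<^esub> x \<in> H" by (simp add: smult_uminus_one)
    then show ?thesis by (simp add: a_inv_def)
  qed
  then show "submodule H R M"
    using H by (unfold_locales) auto
qed

lemma submodule_minus: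
  assumes "submodule H R M" "x \<in> H" "y \<in> H"
  shows "x \<ominus>\<^bsub>M\<^esub> y \<in> H"
proof -
  have "(\<ominus> \<one>) \<odot>\<^bsub>M\<^esub> y \<in> H" using assms by (auto simp: submodule_iff)
  then have "x \<oplus>\<^bsub>M\<^esub> (\<ominus> \<one>) \<odot>\<^bsub>M\<^esub> y \<in> H" using assms by (auto simp: submodule_iff)
  moreover have "y \<in> carrier M" using assms by (auto simp: submodule_iff)
  ultimately show ?thesis by (simp add: smult_uminus_one a_minus_def)
qed

lemma submodule_carrier: "submodule (carrier M) R M"
  by (simp add: submodule_iff)

lemma submodule_zero: "submodule {\<zero>\<^bsub>M\<^esub>} R M"
  by (simp add: submodule_iff)

lemma submodule_Int:
  assumes "submodule H R M" "submodule K R M" shows "submodule (H \<inter> K) R M"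
  using assms by (auto simp: submodule_iff)

lemma submodule_nonzero:
  assumes "submodule H R M" "H \<noteq> {\<zero>\<^bsub>M\<^esub>}"
  obtains x where "x \<in> H" "x \<noteq> \<zero>\<^bsub>M\<^esub>"
  using assms by (auto simp: submodule_iff)

section \<open>Sums of two submodules and cyclic submodules\<close>

definition submodule_plus :: "'b set \<Rightarrow> 'b set \<Rightarrow> 'b set" where
  "submodule_plus H K = {x \<oplus>\<^bsub>M\<^esub> y | x y. x \<in> H \<and> y \<in> K}"

lemma submodule_plus:
  assumes "submodule H R M" "submodule K R M"
  shows "submodule (submodule_plus H K) R M"
  unfolding submodule_iff
proof (intro conjI ballI)
  have H: "\<And>x. x \<in> H \<Longrightarrow> x \<in> carrier M" and K: "\<And>x. x \<in> K \<Longrightarrow> x \<in> carrier M"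
    using assms by (auto simp: submodule_iff)
  show "submodule_plus H K \<subseteq> carrier M"
    using H K by (auto simp: submodule_plus_def)
  have "\<zero>\<^bsub>M\<^esub> \<in> H" "\<zero>\<^bsub>M\<^esub> \<in> K" using assms by (auto simp: submodule_iff)
  then show "\<zero>\<^bsub>M\<^esub> \<in> submodule_plus H K"
    unfolding submodule_plus_def using M.l_zero[OF M.zero_closed] by force
  fix u assume "u \<in> submodule_plus H K"
  then obtain x y where u: "u = x \<oplus>\<^bsub>M\<^esub> y" "x \<in> H" "y \<in> K" by (auto simp: submodule_plus_def)
  {
    fix v assume "v \<in> submodule_plus H K"
    then obtain x' y' where v: "v = x' \<oplus>\<^bsub>M\<^esub> y'" "x' \<in> H" "y' \<in> K"
      by (auto simp: submodule_plus_def)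
    have "u \<oplus>\<^bsub>M\<^esub> v = (x \<oplus>\<^bsub>M\<^esub> x') \<oplus>\<^bsub>M\<^esub> (y \<oplus>\<^bsub>M\<^esub> y')"
      using u v H K by (simp add: M.a_ac)
    moreover have "x \<oplus>\<^bsub>M\<^esub> x' \<in> H" "y \<oplus>\<^bsub>M\<^esub> y' \<in> K" using assms u v by (auto simp: submodule_iff)
    ultimately show "u \<oplus>\<^bsub>M\<^esub> v \<in> submodule_plus H K" by (auto simp: submodule_plus_def)
  }
  fix r assume r: "r \<in> carrier R"
  have "r \<odot>\<^bsub>M\<^esub> u = r \<odot>\<^bsub>M\<^esub> x \<oplus>\<^bsub>M\<^esub> r \<odot>\<^bsub>M\<^esub> y"
    using u r H K by (simp add: smult_r_distr)
  moreover have "r \<odot>\<^bsub>M\<^esub> x \<in> H" "r \<odot>\<^bsub>M\<^esub> y \<in> K" using assms u r by (auto simp: submodule_iff)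
  ultimately show "r \<odot>\<^bsub>M\<^esub> u \<in> submodule_plus H K" by (auto simp: submodule_plus_def)
qed

lemma submodule_plus_upper:
  assumes "submodule H R M" "submodule K R M"
  shows "H \<subseteq> submodule_plus H K" "K \<subseteq> submodule_plus H K"
proof -
  have *: "H \<subseteq> carrier M" "K \<subseteq> carrier M" "\<zero>\<^bsub>M\<^esub> \<in> H" "\<zero>\<^bsub>M\<^esub> \<in> K"
    using assms by (auto simp: submodule_iff)
  show "H \<subseteq> submodule_plus H K"
  proof
    fix x assume "x \<in> H"
    moreover then have "x = x \<oplus>\<^bsub>M\<^esub> \<zero>\<^bsub>M\<^esub>" using * by auto
    ultimately show "x \<in> submodule_plus H K" unfolding submodule_plus_def using * by blast
  qed
  show "K \<subseteq> submodule_plus H K"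
  proof
    fix x assume "x \<in> K"
    moreover then have "x = \<zero>\<^bsub>M\<^esub> \<oplus>\<^bsub>M\<^esub> x" using * by auto
    ultimately show "x \<in> submodule_plus H K" unfolding submodule_plus_def using * by blast
  qed
qed

lemma submodule_plus_least:
  assumes "submodule L R M" "H \<subseteq> L" "K \<subseteq> L"
  shows "submodule_plus H K \<subseteq> L"
proof -
  have "x \<oplus>\<^bsub>M\<^esub> y \<in> L" if "x \<in> H" "y \<in> K" for x y
    using assms that unfolding submodule_iff by blast
  then show ?thesis by (auto simp: submodule_plus_def)
qed

definition cyclic_submodule :: "'b \<Rightarrow> 'b set" where
  "cyclic_submodule x = {r \<odot>\<^bsub>M\<^esub> x | r. r \<in> carrier R}"

lemma submodule_cyclic:
  assumes "x \<in> carrier M"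
  shows "submodule (cyclic_submodule x) R M"
  unfolding submodule_iff
proof (intro conjI ballI)
  show "cyclic_submodule x \<subseteq> carrier M" using assms by (auto simp: cyclic_submodule_def)
  show "\<zero>\<^bsub>M\<^esub> \<in> cyclic_submodule x"
    unfolding cyclic_submodule_def using smult_l_zero[OF assms] by force
  fix u assume "u \<in> cyclic_submodule x"
  then obtain a where u: "u = a \<odot>\<^bsub>M\<^esub> x" "a \<in> carrier R" by (auto simp: cyclic_submodule_def)
  {
    fix v assume "v \<in> cyclic_submodule x"
    then obtain b where v: "v = b \<odot>\<^bsub>M\<^esub> x" "b \<in> carrier R" by (auto simp: cyclic_submodule_def)
    have "u \<oplus>\<^bsub>M\<^esub> v = (a \<oplus> b) \<odot>\<^bsub>M\<^esub> x" using u v assms by (simp add: smult_l_distr)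
    then show "u \<oplus>\<^bsub>M\<^esub> v \<in> cyclic_submodule x" using u v by (auto simp: cyclic_submodule_def)
  }
  fix r assume r: "r \<in> carrier R"
  have "r \<odot>\<^bsub>M\<^esub> u = (r \<otimes> a) \<odot>\<^bsub>M\<^esub> x" using u r assms by (simp add: smult_assoc1)
  then show "r \<odot>\<^bsub>M\<^esub> u \<in> cyclic_submodule x" using u r by (auto simp: cyclic_submodule_def)
qed

lemma cyclic_submodule_self: "x \<in> carrier M \<Longrightarrow> x \<in> cyclic_submodule x"
  unfolding cyclic_submodule_def by (metis (mono_tags, lifting) R.one_closed mem_Collect_eq smult_one)

section \<open>Sums of families of submodules and the socle\<close>

text \<open>\<open>sum_submodules\<close> is an intersection; the hypothesis puts
  \<open>carrier M\<close> among the sets intersected, which keeps the result inside the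
  module.\<close>

lemma submodule_sum_submodules:
  assumes "\<And>K. K \<in> F \<Longrightarrow> submodule K R M"
  shows "submodule (sum_submodules R M F) R M"
proof -
  have "\<Union>F \<subseteq> carrier M" using assms unfolding submodule_iff by blast
  then have "sum_submodules R M F \<subseteq> carrier M"
    unfolding sum_submodules_def using submodule_carrier by (intro Inter_lower) simp
  moreover have "\<zero>\<^bsub>M\<^esub> \<in> sum_submodules R M F"
    by (simp add: sum_submodules_def submodule_iff)
  moreover have "x \<oplus>\<^bsub>M\<^esub> y \<in> sum_submodules R M F"
    if "x \<in> sum_submodules R M F" "y \<in> sum_submodules R M F" for x y
    using that by (simp add: sum_submodules_def submodule_iff)
  moreover have "r \<odot>\<^bsub>M\<^esub> x \<in> sum_submodules R M F"
    if "r \<in> carrier R" "x \<in> sum_submodules R M F" for r x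
    using that by (simp add: sum_submodules_def submodule_iff)
  ultimately show ?thesis by (simp add: submodule_iff)
qed

lemma submodule_socle: "submodule (socle R M) R M"
  unfolding socle_def by (rule submodule_sum_submodules) (auto simp: simple_submodule_def)

lemma simple_subset_socle: "simple_submodule R M S \<Longrightarrow> S \<subseteq> socle R M"
  by (auto simp: socle_def sum_submodules_def)

text \<open>Read contrapositively, this is the source of simple submodules: if \<open>K\<close> does
  not contain the socle, some simple submodule is not contained in \<open>K\<close>.\<close>

lemma socle_least:
  assumes "submodule K R M" "\<And>S. simple_submodule R M S \<Longrightarrow> S \<subseteq> K"
  shows "socle R M \<subseteq> K"
  using assms by (auto simp: socle_def sum_submodules_def)

lemma simple_Int_trivial:
  assumes "simple_submodule R M S" "submodule K R M" "\<not> S \<subseteq> K"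
  shows "S \<inter> K = {\<zero>\<^bsub>M\<^esub>}"
  using assms submodule_Int[of S K] by (auto simp: simple_submodule_def)

section \<open>Endomorphisms\<close>

lemma hom_closed: "f \<in> module_homs R M M \<Longrightarrow> x \<in> carrier M \<Longrightarrow> f x \<in> carrier M"
  by (auto simp: module_homs_def PiE_iff)

lemma hom_add: "f \<in> module_homs R M M \<Longrightarrow> x \<in> carrier M \<Longrightarrow> y \<in> carrier M \<Longrightarrow>
  f (x \<oplus>\<^bsub>M\<^esub> y) = f x \<oplus>\<^bsub>M\<^esub> f y"
  by (auto simp: module_homs_def)

lemma hom_smult: "f \<in> module_homs R M M \<Longrightarrow> r \<in> carrier R \<Longrightarrow> x \<in> carrier M \<Longrightarrow>
  f (r \<odot>\<^bsub>M\<^esub> x) = r \<odot>\<^bsub>M\<^esub> f x"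
  by (auto simp: module_homs_def)

lemma hom_zero: "f \<in> module_homs R M M \<Longrightarrow> f \<zero>\<^bsub>M\<^esub> = \<zero>\<^bsub>M\<^esub>"
  by (metis M.zero_closed R.zero_closed hom_closed hom_smult smult_l_zero)

lemma submodule_hom_vimage:
  assumes "f \<in> module_homs R M M" "submodule K R M"
  shows "submodule {x \<in> carrier M. f x \<in> K} R M"
  using assms by (auto simp: submodule_iff hom_add hom_smult hom_zero)

lemma submodule_hom_image:
  assumes f: "f \<in> module_homs R M M" and K: "submodule K R M"
  shows "submodule (f ` K) R M"
  unfolding submodule_iff
proof (intro conjI ballI)
  have c: "K \<subseteq> carrier M" "\<zero>\<^bsub>M\<^esub> \<in> K" using K by (auto simp: submodule_iff)
  show "f ` K \<subseteq> carrier M" using f c hom_closed by blast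
  show "\<zero>\<^bsub>M\<^esub> \<in> f ` K" using f c hom_zero by (metis image_eqI)
  fix u assume "u \<in> f ` K"
  then obtain x where x: "u = f x" "x \<in> K" by auto
  {
    fix v assume "v \<in> f ` K"
    then obtain y where y: "v = f y" "y \<in> K" by auto
    have "u \<oplus>\<^bsub>M\<^esub> v = f (x \<oplus>\<^bsub>M\<^esub> y)" using x y c f by (simp add: hom_add subset_iff)
    moreover have "x \<oplus>\<^bsub>M\<^esub> y \<in> K" using K x y by (auto simp: submodule_iff)
    ultimately show "u \<oplus>\<^bsub>M\<^esub> v \<in> f ` K" by auto
  }
  fix r assume r: "r \<in> carrier R"
  have "r \<odot>\<^bsub>M\<^esub> u = f (r \<odot>\<^bsub>M\<^esub> x)" using x r c f by (simp add: hom_smult subset_iff)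
  moreover have "r \<odot>\<^bsub>M\<^esub> x \<in> K" using K x r by (auto simp: submodule_iff)
  ultimately show "r \<odot>\<^bsub>M\<^esub> u \<in> f ` K" by auto
qed

lemma hom_comp:
  assumes "f \<in> module_homs R M M" "g \<in> module_homs R M M"
  shows "(\<lambda>x\<in>carrier M. g (f x)) \<in> module_homs R M M"
  using assms
  by (auto simp: module_homs_def PiE_iff)

section \<open>The ring of endomorphisms\<close>

lemma ring_endo_ring: "ring (endo_ring R M)"
proof (rule ringI)
  let ?E = "endo_ring R M"
  have car: "carrier ?E = module_homs R M M" by (simp add: endo_ring_def)
  have ext: "f = g" if "f \<in> module_homs R M M" "g \<in> module_homs R M M"
    "\<And>x. x \<in> carrier M \<Longrightarrow> f x = g x" for f g
    using that by (auto simp: module_homs_def intro: PiE_ext)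
  have addc: "(\<lambda>x\<in>carrier M. f x \<oplus>\<^bsub>M\<^esub> g x) \<in> module_homs R M M"
    if "f \<in> module_homs R M M" "g \<in> module_homs R M M" for f g
    using that by (auto simp: module_homs_def PiE_iff smult_r_distr M.a_ac)
  have zeroc: "(\<lambda>x\<in>carrier M. \<zero>\<^bsub>M\<^esub>) \<in> module_homs R M M"
    by (auto simp: module_homs_def)
  have onec: "(\<lambda>x\<in>carrier M. x) \<in> module_homs R M M"
    by (auto simp: module_homs_def)
  show "abelian_group ?E"
  proof (rule abelian_groupI, unfold car)
    fix f assume f: "f \<in> module_homs R M M"
    \<comment> \<open>The negative of \<open>f\<close> is written with the scalar -1. This scalar
      commutes with all of \<open>R\<close>, so the map is linear although \<open>R\<close> need not
      be commutative.\<close>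
    have n: "(\<lambda>x\<in>carrier M. (\<ominus> \<one>) \<odot>\<^bsub>M\<^esub> f x) \<in> module_homs R M M"
      using f by (auto simp: module_homs_def PiE_iff smult_r_distr smult_assoc1[symmetric]
          R.l_minus R.r_minus)
    moreover have "(\<lambda>x\<in>carrier M. (\<ominus> \<one>) \<odot>\<^bsub>M\<^esub> f x) \<oplus>\<^bsub>?E\<^esub> f = \<zero>\<^bsub>?E\<^esub>"
      by (auto simp: endo_ring_def restrict_def smult_uminus_one hom_closed[OF f] M.l_neg)
    ultimately show "\<exists>g\<in>module_homs R M M. g \<oplus>\<^bsub>?E\<^esub> f = \<zero>\<^bsub>?E\<^esub>" by blast
    show "\<zero>\<^bsub>?E\<^esub> \<oplus>\<^bsub>?E\<^esub> f = f"
      using f addc[OF zeroc f] by (intro ext) (auto simp: endo_ring_def hom_closed)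
  next
    fix f g assume f: "f \<in> module_homs R M M" and g: "g \<in> module_homs R M M"
    show "f \<oplus>\<^bsub>?E\<^esub> g \<in> module_homs R M M" using addc[OF f g] by (simp add: endo_ring_def)
    show "f \<oplus>\<^bsub>?E\<^esub> g = g \<oplus>\<^bsub>?E\<^esub> f"
      using f g by (auto simp: endo_ring_def restrict_def hom_closed M.a_comm)
    fix h assume h: "h \<in> module_homs R M M"
    show "f \<oplus>\<^bsub>?E\<^esub> g \<oplus>\<^bsub>?E\<^esub> h = f \<oplus>\<^bsub>?E\<^esub> (g \<oplus>\<^bsub>?E\<^esub> h)"
      using f g h by (auto simp: endo_ring_def restrict_def hom_closed M.a_assoc)
  next
    show "\<zero>\<^bsub>?E\<^esub> \<in> module_homs R M M" using zeroc by (simp add: endo_ring_def)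
  qed
  show "monoid ?E"
  proof (rule monoidI, unfold car)
    fix f assume f: "f \<in> module_homs R M M"
    show "\<one>\<^bsub>?E\<^esub> \<otimes>\<^bsub>?E\<^esub> f = f"
      using f hom_comp[OF onec f] by (intro ext) (auto simp: endo_ring_def hom_closed)
    show "f \<otimes>\<^bsub>?E\<^esub> \<one>\<^bsub>?E\<^esub> = f"
      using f hom_comp[OF f onec] by (intro ext) (auto simp: endo_ring_def hom_closed)
    fix g assume g: "g \<in> module_homs R M M"
    show "f \<otimes>\<^bsub>?E\<^esub> g \<in> module_homs R M M" using hom_comp[OF f g] by (simp add: endo_ring_def)
    fix h assume h: "h \<in> module_homs R M M"
    show "f \<otimes>\<^bsub>?E\<^esub> g \<otimes>\<^bsub>?E\<^esub> h = f \<otimes>\<^bsub>?E\<^esub> (g \<otimes>\<^bsub>?E\<^esub> h)"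
      using f g h by (auto simp: endo_ring_def restrict_def hom_closed)
  next
    show "\<one>\<^bsub>?E\<^esub> \<in> module_homs R M M" using onec by (simp add: endo_ring_def)
  qed
  fix f g h assume "f \<in> carrier ?E" "g \<in> carrier ?E" "h \<in> carrier ?E"
  then have fgh: "f \<in> module_homs R M M" "g \<in> module_homs R M M" "h \<in> module_homs R M M"
    by (auto simp: car)
  show "(f \<oplus>\<^bsub>?E\<^esub> g) \<otimes>\<^bsub>?E\<^esub> h = f \<otimes>\<^bsub>?E\<^esub> h \<oplus>\<^bsub>?E\<^esub> g \<otimes>\<^bsub>?E\<^esub> h"
    using fgh by (auto simp: endo_ring_def restrict_def hom_closed hom_add)
  show "h \<otimes>\<^bsub>?E\<^esub> (f \<oplus>\<^bsub>?E\<^esub> g) = h \<otimes>\<^bsub>?E\<^esub> f \<oplus>\<^bsub>?E\<^esub> h \<otimes>\<^bsub>?E\<^esub> g"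
    using fgh by (auto simp: endo_ring_def restrict_def hom_closed)
qed

lemma simple_hom_image:
  assumes f: "f \<in> module_homs R M M" and S: "simple_submodule R M S"
    and ne: "f ` S \<noteq> {\<zero>\<^bsub>M\<^esub>}"
  shows "simple_submodule R M (f ` S)"
  unfolding simple_submodule_def
proof (intro conjI allI impI)
  have Ssub: "submodule S R M" using S by (simp add: simple_submodule_def)
  show "submodule (f ` S) R M" using f Ssub by (rule submodule_hom_image)
  show "f ` S \<noteq> {\<zero>\<^bsub>M\<^esub>}" by fact
  fix K assume K: "submodule K R M \<and> K \<subseteq> f ` S"
  let ?V = "S \<inter> {x \<in> carrier M. f x \<in> K}"
  have "submodule ?V R M" using Ssub K f by (blast intro: submodule_Int submodule_hom_vimage)
  then have "?V = {\<zero>\<^bsub>M\<^esub>} \<or> ?V = S" using S by (auto simp: simple_submodule_def)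
  moreover have "S \<subseteq> carrier M" using Ssub by (simp add: submodule_iff)
  then have "K = f ` ?V" using K by blast
  ultimately show "K = {\<zero>\<^bsub>M\<^esub>} \<or> K = f ` S"
    using hom_zero[OF f] by auto
qed

section \<open>Star-prime modules with a simple submodule\<close>

text \<open>If every homomorphism from \<open>M\<close> to \<open>L\<close> killed \<open>N\<close>,
  the zero submodule would contain all the images that \<open>star_prod\<close> sums up. A
  homomorphism into \<open>L\<close> is also an endomorphism of \<open>M\<close>, since only the
  carrier of the record is changed.\<close>

lemma star_prime_hom:
  assumes "star_prime R M" "submodule N R M" "submodule L R M" "N \<noteq> {\<zero>\<^bsub>M\<^esub>}" "L \<noteq> {\<zero>\<^bsub>M\<^esub>}"
  obtains f x where "f \<in> module_homs R M M" "f ` carrier M \<subseteq> L" "x \<in> N" "f x \<noteq> \<zero>\<^bsub>M\<^esub>"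
proof -
  let ?F = "{f ` N | f. f \<in> module_homs R M (M\<lparr>carrier := L\<rparr>)}"
  have ne: "sum_submodules R M ?F \<noteq> {\<zero>\<^bsub>M\<^esub>}"
    using assms by (auto simp: star_prime_def star_prod_def)
  have "\<not> \<Union> ?F \<subseteq> {\<zero>\<^bsub>M\<^esub>}"
  proof
    assume "\<Union> ?F \<subseteq> {\<zero>\<^bsub>M\<^esub>}"
    then have "sum_submodules R M ?F \<subseteq> {\<zero>\<^bsub>M\<^esub>}"
      unfolding sum_submodules_def using submodule_zero by blast
    moreover have "\<zero>\<^bsub>M\<^esub> \<in> sum_submodules R M ?F"
      by (auto simp: sum_submodules_def submodule_iff)
    ultimately show False using ne by blast
  qed
  then obtain f x where f: "f \<in> module_homs R M (M\<lparr>carrier := L\<rparr>)" and x: "x \<in> N" "f x \<noteq> \<zero>\<^bsub>M\<^esub>"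
    by blast
  have "L \<subseteq> carrier M" using assms by (auto simp: submodule_iff)
  then have "f \<in> module_homs R M M" "f ` carrier M \<subseteq> L"
    using f by (auto simp: module_homs_def PiE_iff)
  then show thesis using that x by blast
qed

text \<open>Take \<open>N = R x\<close>: from f(r x) = r f(x), a map that does not kill
  \<open>R x\<close> does not kill \<open>x\<close>. Thus \<open>L\<close> cogenerates
  \<open>M\<close>.\<close>

lemma star_prime_hom_elem:
  assumes "star_prime R M" "submodule L R M" "L \<noteq> {\<zero>\<^bsub>M\<^esub>}" "x \<in> carrier M" "x \<noteq> \<zero>\<^bsub>M\<^esub>"
  obtains f where "f \<in> module_homs R M M" "f ` carrier M \<subseteq> L" "f x \<noteq> \<zero>\<^bsub>M\<^esub>"
proof -
  have "cyclic_submodule x \<noteq> {\<zero>\<^bsub>M\<^esub>}" using cyclic_submodule_self[of x] assms by auto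
  then obtain f y where f: "f \<in> module_homs R M M" "f ` carrier M \<subseteq> L"
    and y: "y \<in> cyclic_submodule x" "f y \<noteq> \<zero>\<^bsub>M\<^esub>"
    using star_prime_hom[OF assms(1) submodule_cyclic[OF assms(4)] assms(2)] assms(3) by metis
  then have "f x \<noteq> \<zero>\<^bsub>M\<^esub>"
    using assms(4) by (auto simp: cyclic_submodule_def hom_smult)
  then show thesis using that f by blast
qed

text \<open>A map into \<open>L\<close> that does not kill \<open>S\<close> has a simple image of
  \<open>S\<close> inside \<open>L\<close>. This makes the socle essential.\<close>

lemma star_prime_simple_in_submodule:
  assumes "star_prime R M" "simple_submodule R M S" "submodule L R M" "L \<noteq> {\<zero>\<^bsub>M\<^esub>}"
  obtains T where "simple_submodule R M T" "T \<subseteq> L"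
proof -
  have S: "submodule S R M" "S \<noteq> {\<zero>\<^bsub>M\<^esub>}" using assms(2) by (auto simp: simple_submodule_def)
  obtain f x where f: "f \<in> module_homs R M M" "f ` carrier M \<subseteq> L" and x: "x \<in> S" "f x \<noteq> \<zero>\<^bsub>M\<^esub>"
    using star_prime_hom[OF assms(1) S(1) assms(3) S(2) assms(4)] by metis
  have "simple_submodule R M (f ` S)" using f x assms(2) by (intro simple_hom_image) auto
  moreover have "f ` S \<subseteq> L" using f S by (auto simp: submodule_iff)
  ultimately show thesis using that by blast
qed

section \<open>Primeness of the endomorphism ring of a semisimple star-prime module\<close>

lemma prime_endo_ring_if_socle_eq:
  assumes sp: "star_prime R M" and soc: "socle R M = carrier M" and nz: "carrier M \<noteq> {\<zero>\<^bsub>M\<^esub>}"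
  shows "prime_ring (endo_ring R M)"
  unfolding prime_ring_def
proof (intro conjI allI impI)
  let ?E = "endo_ring R M"
  have car: "carrier ?E = module_homs R M M" by (simp add: endo_ring_def)
  interpret E: ring ?E by (rule ring_endo_ring)
  show "ring ?E" by (rule ring_endo_ring)
  obtain x where x: "x \<in> carrier M" "x \<noteq> \<zero>\<^bsub>M\<^esub>" using nz M.zero_closed by blast
  then show "\<one>\<^bsub>?E\<^esub> \<noteq> \<zero>\<^bsub>?E\<^esub>"
    by (auto simp: endo_ring_def dest!: fun_cong[of _ _ x])
  fix I J assume IJ: "ideal I ?E \<and> ideal J ?E \<and> ideal_prod ?E I J = {\<zero>\<^bsub>?E\<^esub>}"
  interpret I: ideal I ?E using IJ by simp
  interpret J: ideal J ?E using IJ by simp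
  have nonzero: "\<exists>x\<in>carrier M. f x \<noteq> \<zero>\<^bsub>M\<^esub>" if "f \<in> carrier ?E" "f \<noteq> \<zero>\<^bsub>?E\<^esub>" for f
  proof (rule ccontr)
    assume "\<not> (\<exists>x\<in>carrier M. f x \<noteq> \<zero>\<^bsub>M\<^esub>)"
    \<comment> \<open>Both functions are \<open>undefined\<close> outside \<open>carrier M\<close>,
      so agreement on the carrier gives equality.\<close>
    then have "f = (\<lambda>x\<in>carrier M. \<zero>\<^bsub>M\<^esub>)"
      using that(1) by (intro extensionalityI[of _ "carrier M"])
        (auto simp: car module_homs_def PiE_iff)
    then show False using that(2) by (simp add: endo_ring_def)
  qed
  show "I = {\<zero>\<^bsub>?E\<^esub>} \<or> J = {\<zero>\<^bsub>?E\<^esub>}"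
  proof (rule ccontr)
    assume "\<not> (I = {\<zero>\<^bsub>?E\<^esub>} \<or> J = {\<zero>\<^bsub>?E\<^esub>})"
    then obtain f g where f: "f \<in> I" "f \<noteq> \<zero>\<^bsub>?E\<^esub>" and g: "g \<in> J" "g \<noteq> \<zero>\<^bsub>?E\<^esub>"
      using I.zero_closed J.zero_closed by blast
    then have fE: "f \<in> module_homs R M M" and gE: "g \<in> module_homs R M M"
      using I.Icarr J.Icarr car by auto
    obtain x where x: "x \<in> carrier M" "f x \<noteq> \<zero>\<^bsub>M\<^esub>" using nonzero f I.Icarr by blast
    \<comment> \<open>The kernel of \<open>g\<close>, phrased as the preimage of the zero submodule
      so that \<open>submodule_hom_vimage\<close> applies.\<close>
    let ?K = "{x \<in> carrier M. g x \<in> {\<zero>\<^bsub>M\<^esub>}}"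
    have K: "submodule ?K R M" using gE submodule_zero by (rule submodule_hom_vimage)
    obtain y where y: "y \<in> carrier M" "g y \<noteq> \<zero>\<^bsub>M\<^esub>" using nonzero g J.Icarr by blast
    \<comment> \<open>The kernel of \<open>g\<close> is proper and the socle is everything, so some
      simple \<open>T\<close> lies outside the kernel; then \<open>g\<close> is injective on
      \<open>T\<close>.\<close>
    then have "\<not> socle R M \<subseteq> ?K" using soc by auto
    then obtain T where T: "simple_submodule R M T" "\<not> T \<subseteq> ?K" using socle_least[OF K] by blast
    have TK: "T \<inter> ?K = {\<zero>\<^bsub>M\<^esub>}" using T(1) K T(2) by (rule simple_Int_trivial)
    have T': "submodule T R M" "T \<noteq> {\<zero>\<^bsub>M\<^esub>}" using T by (auto simp: simple_submodule_def)
    obtain h where h: "h \<in> module_homs R M M" "h ` carrier M \<subseteq> T" "h (f x) \<noteq> \<zero>\<^bsub>M\<^esub>"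
      using star_prime_hom_elem[OF sp T' hom_closed[OF fE x(1)] x(2)] by blast
    have hfx: "h (f x) \<in> T" "h (f x) \<in> carrier M" using h fE x hom_closed by blast+
    \<comment> \<open>The ideal \<open>I\<close> absorbs \<open>h\<close>, so the product
      \<open>f h g\<close> lies in \<open>I J = 0\<close>; evaluated at \<open>x\<close> it would
      give g(h(f x)) = 0 with h(f x) a non-zero element of \<open>T\<close>.\<close>
    have "f \<otimes>\<^bsub>?E\<^esub> h \<in> I" using f h car by (simp add: I.I_r_closed)
    then have "(f \<otimes>\<^bsub>?E\<^esub> h) \<otimes>\<^bsub>?E\<^esub> g \<in> ideal_prod ?E I J" using g by (intro ideal_prod.prod)
    then have "(f \<otimes>\<^bsub>?E\<^esub> h) \<otimes>\<^bsub>?E\<^esub> g = \<zero>\<^bsub>?E\<^esub>" using IJ by blast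
    then have "((f \<otimes>\<^bsub>?E\<^esub> h) \<otimes>\<^bsub>?E\<^esub> g) x = \<zero>\<^bsub>?E\<^esub> x" by simp
    then have "g (h (f x)) = \<zero>\<^bsub>M\<^esub>" using x by (simp add: endo_ring_def)
    then show False using TK hfx h by blast
  qed
qed

section \<open>Finite Goldie dimension\<close>

text \<open>Pieces \<open>T n\<close> split off one after another from a descending chain are
  independent. The submodules \<open>A i\<close> bound the sum of the remaining pieces from above,
  so that this infinite sum need not be described by elements.\<close>

lemma independent_if_descending:
  fixes K T :: "nat \<Rightarrow> 'b set"
  assumes K: "\<And>n. submodule (K n) R M" and T: "\<And>n. submodule (T n) R M"
    and desc: "\<And>n. K (Suc n) \<subseteq> K n" and TK: "\<And>n. T n \<subseteq> K n"
    and Int: "\<And>n. T n \<inter> K (Suc n) = {\<zero>\<^bsub>M\<^esub>}"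
  obtains A where "\<And>n. submodule (A n) R M" "\<And>n. A n \<subseteq> K 0"
    "\<And>i j. j \<noteq> i \<Longrightarrow> T j \<subseteq> A i" "\<And>i. T i \<inter> A i = {\<zero>\<^bsub>M\<^esub>}"
proof -
  \<comment> \<open>\<open>P n = T 0 + \<dots> + T (n - 1)\<close>, and \<open>A i = P i + K (i + 1)\<close> contains all \<open>T j\<close> with \<open>j \<noteq> i\<close>.\<close>
  define P where "P = rec_nat {\<zero>\<^bsub>M\<^esub>} (\<lambda>n H. submodule_plus H (T n))"
  have P0: "P 0 = {\<zero>\<^bsub>M\<^esub>}" and PS: "\<And>n. P (Suc n) = submodule_plus (P n) (T n)"
    by (simp_all add: P_def)
  have P: "submodule (P n) R M" for n
    by (induction n) (auto simp: P0 PS intro: submodule_zero submodule_plus T)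
  have PK0: "P n \<subseteq> K 0" for n
  proof (induction n)
    case 0 then show ?case using K[of 0] by (auto simp: P0 submodule_iff)
  next
    case (Suc n)
    have "T n \<subseteq> K 0" using TK[of n] lift_Suc_antimono_le[of K 0 n] desc by auto
    then show ?case unfolding PS using Suc by (intro submodule_plus_least K)
  qed
  have sub: "x \<in> carrier M" if "x \<in> P n \<or> x \<in> K n \<or> x \<in> T n" for x n
    using that P[of n] K[of n] T[of n] by (auto simp: submodule_iff)
  have cancel: "p = t \<ominus>\<^bsub>M\<^esub> k" if "t = p \<oplus>\<^bsub>M\<^esub> k" "p \<in> carrier M" "k \<in> carrier M" for p t k
    using that by (simp add: a_minus_def M.a_assoc M.r_neg)
  have zK: "\<zero>\<^bsub>M\<^esub> \<in> K n" "\<zero>\<^bsub>M\<^esub> \<in> P n" "\<zero>\<^bsub>M\<^esub> \<in> T n" for n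
    using K[of n] P[of n] T[of n] by (auto simp: submodule_iff)
  \<comment> \<open>If \<open>x = p + t\<close> lies in \<open>K (Suc n)\<close>, then
    \<open>p = x - t\<close> lies in \<open>P n\<close> and in \<open>K n\<close>, hence is zero by
    induction; so \<open>x = t\<close> lies in \<open>T n\<close> and in \<open>K (Suc n)\<close>,
    which meet in zero.\<close>
  have PK: "P n \<inter> K n = {\<zero>\<^bsub>M\<^esub>}" for n
  proof (induction n)
    case 0 then show ?case using zK by (auto simp: P0)
  next
    case (Suc n)
    have "x = \<zero>\<^bsub>M\<^esub>" if x: "x \<in> P (Suc n)" "x \<in> K (Suc n)" for x
    proof -
      obtain p t where pt: "x = p \<oplus>\<^bsub>M\<^esub> t" "p \<in> P n" "t \<in> T n"
        using x by (auto simp: PS submodule_plus_def)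
      have "p = x \<ominus>\<^bsub>M\<^esub> t" using pt sub by (intro cancel) blast+
      moreover have "x \<in> K n" "t \<in> K n" using x desc TK pt by blast+
      ultimately have "p \<in> K n" using submodule_minus[OF K] by simp
      then have "p = \<zero>\<^bsub>M\<^esub>" using Suc pt by blast
      then have "x = t" using pt sub[of t n] by simp
      then show ?thesis using x pt Int by blast
    qed
    then show ?case using zK by blast
  qed
  define A where "A i = submodule_plus (P i) (K (Suc i))" for i
  show thesis
  proof
    show "submodule (A n) R M" for n unfolding A_def by (intro submodule_plus P K)
    have anti: "K m \<subseteq> K n" if "n \<le> m" for m n
      using lift_Suc_antimono_le[of K, OF desc that] .
    show "A n \<subseteq> K 0" for n unfolding A_def using anti PK0 by (intro submodule_plus_least K) auto
    show "T j \<subseteq> A i" if "j \<noteq> i" for i j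
    proof (cases "j < i")
      case True
      have "P m \<subseteq> P n" if "m \<le> n" for m n
        using that by (rule lift_Suc_mono_le[of P, rotated]) (auto simp: PS intro: submodule_plus_upper(1)[OF P T, THEN subsetD])
      then have "P (Suc j) \<subseteq> P i" using True by (meson Suc_leI)
      then show ?thesis
        using submodule_plus_upper(2)[OF P T, of j j] submodule_plus_upper(1)[OF P K, of i "Suc i"]
        by (auto simp: A_def PS)
    next
      \<comment> \<open>Here \<open>j > i\<close>, so \<open>T j\<close> lies in \<open>K j\<close>,
        below \<open>K (Suc i)\<close>.\<close>
      case False
      then have "K j \<subseteq> K (Suc i)" using that by (intro anti) auto
      then show ?thesis
        using TK[of j] submodule_plus_upper(2)[OF P K, of "Suc i" i] by (auto simp: A_def)
    qed
    show "T i \<inter> A i = {\<zero>\<^bsub>M\<^esub>}" for i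
    proof -
      \<comment> \<open>The same subtraction: in \<open>t = p + k\<close> the part \<open>p\<close>
        lies in \<open>P i\<close> and in \<open>K i\<close>, so only \<open>t = k\<close>
        remains.\<close>
      have "t = \<zero>\<^bsub>M\<^esub>" if t: "t \<in> T i" "t \<in> A i" for t
      proof -
        obtain p k where pk: "t = p \<oplus>\<^bsub>M\<^esub> k" "p \<in> P i" "k \<in> K (Suc i)"
          using t by (auto simp: A_def submodule_plus_def)
        have "p = t \<ominus>\<^bsub>M\<^esub> k" using pk sub by (intro cancel) blast+
        moreover have "t \<in> K i" "k \<in> K i" using t pk TK desc by blast+
        ultimately have "p \<in> K i" using submodule_minus[OF K] by simp
        then have "p = \<zero>\<^bsub>M\<^esub>" using PK pk by blast
        then have "t = k" using pk sub[of k "Suc i"] by simp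
        then show ?thesis using t pk Int by blast
      qed
      moreover have "\<zero>\<^bsub>M\<^esub> \<in> A i"
        using \<open>\<And>n. submodule (A n) R M\<close>[of i] by (simp add: submodule_iff)
      ultimately show ?thesis using zK by blast
    qed
  qed
qed

text \<open>
  The predicate \<^const>\<open>left_qfd\<close> only speaks about modules whose elements are sets of ring elements, so
  \<open>R m\<close> is replaced by the isomorphic copy whose elements are the cosets of the annihilator of \<open>m\<close>.
  The multiplication and the unit of the record are junk.
\<close>

definition transport_module :: "('b \<Rightarrow> 'c) \<Rightarrow> 'b set \<Rightarrow> ('a, 'c) module" where
  "transport_module \<phi> C =
     \<lparr>carrier = \<phi> ` C, monoid.mult = (\<lambda>_ _. \<phi> \<zero>\<^bsub>M\<^esub>), one = \<phi> \<zero>\<^bsub>M\<^esub>, zero = \<phi> \<zero>\<^bsub>M\<^esub>,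
      add = (\<lambda>X Y. \<phi> (inv_into C \<phi> X \<oplus>\<^bsub>M\<^esub> inv_into C \<phi> Y)),
      smult = (\<lambda>r X. \<phi> (r \<odot>\<^bsub>M\<^esub> inv_into C \<phi> X))\<rparr>"

text \<open>Injectivity makes \<open>inv_into\<close> a true inverse on \<open>C\<close>, so \<phi>
  carries the operations of \<open>C\<close> to those of the copy, and with them the axioms and the
  submodules.\<close>

lemma
  assumes C: "submodule C R M" and inj: "inj_on \<phi> C"
  shows left_module_transport: "left_module R (transport_module \<phi> C)"
    and submodule_transport: "\<And>K. submodule K R M \<Longrightarrow> K \<subseteq> C \<Longrightarrow>
      submodule (\<phi> ` K) R (transport_module \<phi> C)"
proof -
  let ?N = "transport_module \<phi> C"
  have CM: "x \<in> carrier M" if "x \<in> C" for x using C that by (auto simp: submodule_iff)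
  have Cz: "\<zero>\<^bsub>M\<^esub> \<in> C" and Ca: "\<And>x y. x \<in> C \<Longrightarrow> y \<in> C \<Longrightarrow> x \<oplus>\<^bsub>M\<^esub> y \<in> C"
    and Cs: "\<And>r x. r \<in> carrier R \<Longrightarrow> x \<in> C \<Longrightarrow> r \<odot>\<^bsub>M\<^esub> x \<in> C"
    using C by (auto simp: submodule_iff)
  have car: "carrier ?N = \<phi> ` C" and zero: "\<zero>\<^bsub>?N\<^esub> = \<phi> \<zero>\<^bsub>M\<^esub>"
    by (simp_all add: transport_module_def)
  have add: "\<phi> x \<oplus>\<^bsub>?N\<^esub> \<phi> y = \<phi> (x \<oplus>\<^bsub>M\<^esub> y)" if "x \<in> C" "y \<in> C" for x y
    using that by (simp add: transport_module_def inv_into_f_f[OF inj])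
  have smult: "r \<odot>\<^bsub>?N\<^esub> \<phi> x = \<phi> (r \<odot>\<^bsub>M\<^esub> x)" if "x \<in> C" for r x
    using that by (simp add: transport_module_def inv_into_f_f[OF inj])
  have "abelian_group ?N"
  proof (rule abelian_groupI, unfold car)
    fix X assume "X \<in> \<phi> ` C"
    then obtain x where x: "X = \<phi> x" "x \<in> C" by auto
    show "\<zero>\<^bsub>?N\<^esub> \<oplus>\<^bsub>?N\<^esub> X = X" using x Cz CM by (simp add: zero add)
    have "\<ominus>\<^bsub>M\<^esub> x \<in> C" using Cs[of "\<ominus> \<one>" x] x CM by (simp add: smult_uminus_one)
    then show "\<exists>Y\<in>\<phi> ` C. Y \<oplus>\<^bsub>?N\<^esub> X = \<zero>\<^bsub>?N\<^esub>"
      using x CM by (intro bexI[of _ "\<phi> (\<ominus>\<^bsub>M\<^esub> x)"]) (auto simp: add zero M.l_neg)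
  qed (auto simp: zero add Cz Ca CM M.a_ac)
  then show lm: "left_module R ?N"
    by (intro left_module.intro left_module_axioms.intro)
      (auto simp: car add smult Cz Ca Cs CM smult_l_distr smult_r_distr smult_assoc1 R.ring_axioms)
  fix K assume K: "submodule K R M" "K \<subseteq> C"
  interpret N: left_module R ?N by (rule lm)
  have KC: "x \<in> C" if "x \<in> K" for x using K that by auto
  show "submodule (\<phi> ` K) R ?N"
    unfolding N.submodule_iff using K KC
    by (auto simp: car zero add smult submodule_iff)
qed

text \<open>\<open>A i\<close> is one of the submodules intersected in the sum of all
  \<open>T j\<close> with \<open>j \<noteq> i\<close>, so it contains that sum.\<close>

lemma not_finite_goldie_dim_if_independent:
  fixes T :: "nat \<Rightarrow> 'b set"
  assumes "\<And>n. submodule (T n) R M" "\<And>n. T n \<noteq> {\<zero>\<^bsub>M\<^esub>}" "\<And>n. submodule (A n) R M"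
    and "\<And>i j. j \<noteq> i \<Longrightarrow> T j \<subseteq> A i" "\<And>i. T i \<inter> A i = {\<zero>\<^bsub>M\<^esub>}"
  shows "\<not> finite_goldie_dim R M"
proof -
  have "T i \<inter> sum_submodules R M {T j | j. j \<noteq> i} = {\<zero>\<^bsub>M\<^esub>}" for i
  proof -
    have "sum_submodules R M {T j | j. j \<noteq> i} \<subseteq> A i"
      unfolding sum_submodules_def using assms(3)[of i] assms(4)[of _ i] by (intro Inter_lower) blast
    moreover have "submodule (sum_submodules R M {T j | j. j \<noteq> i}) R M"
      using assms(1) by (intro submodule_sum_submodules) auto
    ultimately show ?thesis using assms(1)[of i] assms(5)[of i] by (auto simp: submodule_iff)
  qed
  then show ?thesis using assms(1,2) unfolding finite_goldie_dim_def by blast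
qed

lemma no_independent_in_cyclic_if_qfd:
  fixes T :: "nat \<Rightarrow> 'b set"
  assumes qfd: "left_qfd R" and m: "m \<in> carrier M"
    and T: "\<And>n. submodule (T n) R M" "\<And>n. T n \<noteq> {\<zero>\<^bsub>M\<^esub>}"
    and A: "\<And>n. submodule (A n) R M" "\<And>n. A n \<subseteq> cyclic_submodule m"
    and TA: "\<And>i j. j \<noteq> i \<Longrightarrow> T j \<subseteq> A i" "\<And>i. T i \<inter> A i = {\<zero>\<^bsub>M\<^esub>}"
  shows False
proof -
  let ?C = "cyclic_submodule m"
  \<comment> \<open>For \<open>y\<close> in \<open>R m\<close> this is a coset of the annihilator of
    \<open>m\<close>. It is non-empty, and any of its elements recovers \<open>y\<close>; hence
    \<phi> is injective on \<open>R m\<close>.\<close>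
  define \<phi> where "\<phi> y = {r \<in> carrier R. r \<odot>\<^bsub>M\<^esub> m = y}" for y
  have inj: "inj_on \<phi> ?C"
    by (auto simp: inj_on_def \<phi>_def cyclic_submodule_def)
  have C: "submodule ?C R M" by (rule submodule_cyclic[OF m])
  let ?N = "transport_module \<phi> ?C"
  interpret N: left_module R ?N by (rule left_module_transport[OF C inj])
  \<comment> \<open>\<open>Suc n\<close> serves merely as an index different from
    \<open>n\<close>.\<close>
  have TC: "T n \<subseteq> ?C" for n using TA(1)[of n "Suc n"] A(2)[of "Suc n"] by auto
  have zero: "\<phi> ` {\<zero>\<^bsub>M\<^esub>} = {\<zero>\<^bsub>?N\<^esub>}" by (simp add: transport_module_def)
  have zC: "{\<zero>\<^bsub>M\<^esub>} \<subseteq> ?C" using C by (auto simp: submodule_iff)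
  have "\<not> finite_goldie_dim R ?N"
  proof (rule N.not_finite_goldie_dim_if_independent[of "\<lambda>n. \<phi> ` T n" "\<lambda>n. \<phi> ` A n"])
    show "submodule (\<phi> ` T n) R ?N" "submodule (\<phi> ` A n) R ?N" for n
      by (intro submodule_transport[OF C inj] T A TC)+
    show "\<phi> ` T n \<noteq> {\<zero>\<^bsub>?N\<^esub>}" for n
      using T(2)[of n] inj_on_image_eq_iff[OF inj TC zC, of n] by (simp add: zero[symmetric])
    show "\<phi> ` T j \<subseteq> \<phi> ` A i" if "j \<noteq> i" for i j using TA(1)[OF that] by auto
    show "\<phi> ` T i \<inter> \<phi> ` A i = {\<zero>\<^bsub>?N\<^esub>}" for i
      using inj_on_image_Int[OF inj TC A(2), of i i] TA(2)[of i] by (simp add: zero[symmetric])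
  qed
  moreover have "cyclic_module R ?N"
    unfolding cyclic_module_def
  proof (intro bexI)
    have "m \<in> ?C" using m by (rule cyclic_submodule_self)
    then show "\<phi> m \<in> carrier ?N" by (simp add: transport_module_def)
    have "r \<odot>\<^bsub>?N\<^esub> \<phi> m = \<phi> (r \<odot>\<^bsub>M\<^esub> m)" for r
      using \<open>m \<in> ?C\<close> by (simp add: transport_module_def inv_into_f_f[OF inj])
    then show "carrier ?N = {r \<odot>\<^bsub>?N\<^esub> \<phi> m | r. r \<in> carrier R}"
      by (auto simp: transport_module_def cyclic_submodule_def)
  qed
  ultimately show False using qfd N.left_module_axioms unfolding left_qfd_def by blast
qed

section \<open>The socle over a left qfd ring\<close>

lemma socle_eq_carrier_if_qfd:
  assumes qfd: "left_qfd R" and sp: "star_prime R M" and S: "simple_submodule R M S"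
  shows "socle R M = carrier M"
proof (rule ccontr)
  assume "socle R M \<noteq> carrier M"
  moreover have "socle R M \<subseteq> carrier M" using submodule_socle by (auto simp: submodule_iff)
  ultimately obtain m where m: "m \<in> carrier M" "m \<notin> socle R M" by blast
  \<comment> \<open>\<open>P\<close> is the invariant of the repeated splitting, for submodules of
    \<open>R m\<close> outside the socle. \<open>Q C C'\<close> says that passing from
    \<open>C\<close> to \<open>C'\<close> frees a non-zero \<open>T\<close> independent of
    \<open>C'\<close>.\<close>
  define P where "P C \<longleftrightarrow> submodule C R M \<and> C \<subseteq> cyclic_submodule m \<and> \<not> C \<subseteq> socle R M" for C
  define Q where "Q C C' \<longleftrightarrow> C' \<subseteq> C \<and> (\<exists>T. submodule T R M \<and> T \<noteq> {\<zero>\<^bsub>M\<^esub>} \<and> T \<subseteq> C \<and>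
    T \<inter> C' = {\<zero>\<^bsub>M\<^esub>})" for C C'
  have step: "\<exists>C'. P C' \<and> Q C C'" if "P C" for C
  proof -
    have C: "submodule C R M" "C \<subseteq> cyclic_submodule m" "\<not> C \<subseteq> socle R M"
      using that by (auto simp: P_def)
    then have "C \<noteq> {\<zero>\<^bsub>M\<^esub>}" using submodule_socle by (auto simp: submodule_iff)
    then obtain T where T: "simple_submodule R M T" "T \<subseteq> C"
      using star_prime_simple_in_submodule[OF sp S C(1)] by blast
    then have T': "submodule T R M" "T \<noteq> {\<zero>\<^bsub>M\<^esub>}" by (auto simp: simple_submodule_def)
    have Tc: "T \<subseteq> carrier M" "C \<subseteq> carrier M" using T' C by (auto simp: submodule_iff)
    obtain t where t: "t \<in> T" "t \<noteq> \<zero>\<^bsub>M\<^esub>" using submodule_nonzero[OF T'] .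
    obtain f where f: "f \<in> module_homs R M M" "f ` carrier M \<subseteq> T" "f t \<noteq> \<zero>\<^bsub>M\<^esub>"
      using star_prime_hom_elem[OF sp T' _ t(2)] t Tc by blast
    define K where "K = {x \<in> carrier M. f x \<in> {\<zero>\<^bsub>M\<^esub>}}"
    have K: "submodule K R M" unfolding K_def using f(1) submodule_zero by (rule submodule_hom_vimage)
    \<comment> \<open>The simple \<open>T\<close> is not inside the kernel \<open>K\<close>, because
      \<open>f t\<close> is non-zero.\<close>
    have TK: "T \<inter> K = {\<zero>\<^bsub>M\<^esub>}" using T K t f by (intro simple_Int_trivial) (auto simp: K_def)
    have "f ` T \<subseteq> T" using f Tc by blast
    moreover have "f ` T \<noteq> {\<zero>\<^bsub>M\<^esub>}" using t f by blast
    \<comment> \<open>\<open>f\<close> maps the simple \<open>T\<close> to a non-zero submodule of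
      itself, hence onto \<open>T\<close>.\<close>
    ultimately have fT: "f ` T = T"
      using T(1) submodule_hom_image[OF f(1) T'(1)] unfolding simple_submodule_def by blast
    \<comment> \<open>For \<open>c\<close> in \<open>C\<close> choose \<open>u\<close> in
      \<open>T\<close> with f(c) = f(u). Then \<open>c - u\<close> lies in
      \<open>C \<inter> K\<close> and \<open>u\<close> in the socle, so \<open>C \<inter> K\<close>
      inside the socle would force \<open>C\<close> into it.\<close>
    have "\<not> C \<inter> K \<subseteq> socle R M"
    proof
      assume CK: "C \<inter> K \<subseteq> socle R M"
      have "c \<in> socle R M" if c: "c \<in> C" for c
      proof -
        have cM: "c \<in> carrier M" using c Tc by blast
        then have "f c \<in> f ` T" using f fT by blast
        then obtain u where u: "u \<in> T" "f c = f u" by blast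
        have uM: "u \<in> carrier M" using u Tc by blast
        let ?d = "c \<ominus>\<^bsub>M\<^esub> u"
        have d: "c = ?d \<oplus>\<^bsub>M\<^esub> u" using cM uM by (simp add: a_minus_def M.a_assoc M.l_neg)
        have "f c = f ?d \<oplus>\<^bsub>M\<^esub> f u" using d hom_add[OF f(1), of ?d u] cM uM by simp
        then have "f ?d = \<zero>\<^bsub>M\<^esub>" using u hom_closed[OF f(1)] cM uM
          by (metis M.add.l_cancel_one' M.minus_closed M.a_comm)
        then have "?d \<in> C \<inter> K" using c u T cM uM submodule_minus[OF C(1)] by (auto simp: K_def)
        then have "?d \<in> socle R M" "u \<in> socle R M"
          using CK u simple_subset_socle[OF T(1)] by blast+
        then show ?thesis using submodule_socle by (subst d) (auto simp: submodule_iff)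
      qed
      then show False using C by blast
    qed
    then have "P (C \<inter> K)" using C K by (auto simp: P_def intro: submodule_Int)
    moreover have "Q C (C \<inter> K)" unfolding Q_def using T T' TK by blast
    ultimately show ?thesis by blast
  qed
  have "P (cyclic_submodule m)"
    using m cyclic_submodule_self submodule_cyclic by (auto simp: P_def)
  \<comment> \<open>Dependent choice iterates the step from \<open>R m\<close> and gives a
    descending chain with a non-zero piece split off at each stage.\<close>
  then obtain K where K: "\<And>n. P (K n)" and Q: "\<And>n. Q (K n) (K (Suc n))"
    using dependent_nat_choice[of "\<lambda>_. P" "\<lambda>_. Q"] step by metis
  obtain T where T: "\<And>n. submodule (T n) R M" "\<And>n. T n \<noteq> {\<zero>\<^bsub>M\<^esub>}" "\<And>n. T n \<subseteq> K n"
    "\<And>n. T n \<inter> K (Suc n) = {\<zero>\<^bsub>M\<^esub>}"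
    using Q unfolding Q_def by metis
  have Ksub: "submodule (K n) R M" for n using K by (simp add: P_def)
  have Kdesc: "K (Suc n) \<subseteq> K n" for n using Q by (simp add: Q_def)
  obtain A where A: "\<And>n. submodule (A n) R M" "\<And>n. A n \<subseteq> K 0"
    "\<And>i j. j \<noteq> i \<Longrightarrow> T j \<subseteq> A i" "\<And>i. T i \<inter> A i = {\<zero>\<^bsub>M\<^esub>}"
    using independent_if_descending[of K T, OF Ksub T(1) Kdesc T(3,4)] by metis
  have "A n \<subseteq> cyclic_submodule m" for n using A(2)[of n] K[of 0] by (auto simp: P_def)
  then show False
    by (rule no_independent_in_cyclic_if_qfd[OF qfd m(1) T(1,2) A(1) _ A(3,4)])
qed

section \<open>Semilocal rings\<close>

lemma left_ideal_iff:
  "left_ideal R I \<longleftrightarrow> I \<subseteq> carrier R \<and> \<zero> \<in> I \<and> (\<forall>x\<in>I. \<forall>y\<in>I. x \<oplus> y \<in> I) \<and>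
     (\<forall>r\<in>carrier R. \<forall>x\<in>I. r \<otimes> x \<in> I)"
  unfolding left_ideal_def left_module.submodule_iff[OF R.left_module_regular]
  by (simp add: regular_module_def)

lemma zero_in_jacobson_radical: "\<zero> \<in> jacobson_radical R"
  by (auto simp: jacobson_radical_def maximal_left_ideal_def left_ideal_iff)

text \<open>If \<open>J\<close> properly contains the annihilator of \<open>s\<close>, then
  \<open>J s\<close> is a non-zero submodule of \<open>S\<close>, hence contains \<open>s\<close>.
  From \<open>s = e s\<close> with \<open>e\<close> in \<open>J\<close> it follows that
  \<open>1 - e\<close> annihilates \<open>s\<close>, so it lies in \<open>J\<close>, and with it
  1.\<close>

lemma maximal_left_ideal_annihilator:
  assumes S: "simple_submodule R M S" and s: "s \<in> S" "s \<noteq> \<zero>\<^bsub>M\<^esub>"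
  shows "maximal_left_ideal R {r \<in> carrier R. r \<odot>\<^bsub>M\<^esub> s = \<zero>\<^bsub>M\<^esub>}" (is "maximal_left_ideal R ?I")
proof -
  have Ssub: "submodule S R M" using S by (simp add: simple_submodule_def)
  have sM: "s \<in> carrier M" using Ssub s by (auto simp: submodule_iff)
  have I: "left_ideal R ?I"
    using sM by (auto simp: left_ideal_iff smult_l_distr smult_assoc1)
  have "\<one> \<notin> ?I" using s sM by simp
  then have ne: "?I \<noteq> carrier R" by (metis R.one_closed)
  have "J = carrier R" if J: "left_ideal R J" "?I \<subseteq> J" "J \<noteq> ?I" for J
  proof -
    have Jc: "J \<subseteq> carrier R" "\<zero> \<in> J" "\<And>x y. x \<in> J \<Longrightarrow> y \<in> J \<Longrightarrow> x \<oplus> y \<in> J"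
      "\<And>r x. r \<in> carrier R \<Longrightarrow> x \<in> J \<Longrightarrow> r \<otimes> x \<in> J" using J(1) by (auto simp: left_ideal_iff)
    let ?K = "(\<lambda>r. r \<odot>\<^bsub>M\<^esub> s) ` J"
    have "submodule ?K R M"
      unfolding submodule_iff
    proof (intro conjI ballI)
      show "?K \<subseteq> carrier M" using Jc sM by auto
      show "\<zero>\<^bsub>M\<^esub> \<in> ?K" using Jc(2) smult_l_zero[OF sM] by (metis image_eqI)
      fix u assume "u \<in> ?K"
      then obtain a where a: "u = a \<odot>\<^bsub>M\<^esub> s" "a \<in> J" by auto
      {
        fix v assume "v \<in> ?K"
        then obtain b where b: "v = b \<odot>\<^bsub>M\<^esub> s" "b \<in> J" by auto
        have "u \<oplus>\<^bsub>M\<^esub> v = (a \<oplus> b) \<odot>\<^bsub>M\<^esub> s"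
          using a b Jc(1) sM by (simp add: smult_l_distr subset_iff)
        then show "u \<oplus>\<^bsub>M\<^esub> v \<in> ?K" using a b Jc by blast
      }
      fix r assume r: "r \<in> carrier R"
      have "r \<odot>\<^bsub>M\<^esub> u = (r \<otimes> a) \<odot>\<^bsub>M\<^esub> s"
        using a r Jc(1) sM by (simp add: smult_assoc1 subset_iff)
      then show "r \<odot>\<^bsub>M\<^esub> u \<in> ?K" using a r Jc by blast
    qed
    moreover have "?K \<subseteq> S" using Jc s Ssub by (auto simp: submodule_iff)
    ultimately have "?K = {\<zero>\<^bsub>M\<^esub>} \<or> ?K = S" using S by (auto simp: simple_submodule_def)
    moreover have "?K \<noteq> {\<zero>\<^bsub>M\<^esub>}"
    proof
      assume "?K = {\<zero>\<^bsub>M\<^esub>}"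
      then have "J \<subseteq> ?I" using Jc by blast
      then show False using J by blast
    qed
    ultimately have KS: "?K = S" by blast
    then obtain e where e: "e \<in> J" "s = e \<odot>\<^bsub>M\<^esub> s" using s by blast
    have eR: "e \<in> carrier R" using e Jc by blast
    \<comment> \<open>The element \<open>1 - e\<close>, with the negative written as a scalar so
      that the module laws apply directly.\<close>
    have "(\<one> \<oplus> (\<ominus> \<one>) \<otimes> e) \<odot>\<^bsub>M\<^esub> s = s \<oplus>\<^bsub>M\<^esub> (\<ominus> \<one>) \<odot>\<^bsub>M\<^esub> s"
      using eR sM e(2) by (simp add: smult_l_distr smult_assoc1)
    also have "\<dots> = \<zero>\<^bsub>M\<^esub>" using sM by (simp add: smult_uminus_one M.r_neg)
    finally have "\<one> \<oplus> (\<ominus> \<one>) \<otimes> e \<in> J" using eR J(2) by auto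
    then have "(\<one> \<oplus> (\<ominus> \<one>) \<otimes> e) \<oplus> e \<in> J" using e Jc by blast
    moreover have "(\<one> \<oplus> (\<ominus> \<one>) \<otimes> e) \<oplus> e = \<one>"
      using eR by (simp add: R.l_minus R.a_assoc R.l_neg)
    ultimately have "\<one> \<in> J" by simp
    then have "r \<in> J" if "r \<in> carrier R" for r using Jc(4)[OF that] that by fastforce
    then show ?thesis using Jc by blast
  qed
  then show ?thesis unfolding maximal_left_ideal_def using I ne by blast
qed

text \<open>Because \<open>S\<close> cogenerates \<open>M\<close>, a non-zero \<open>j m\<close>
  would have a non-zero image \<open>j f(m)\<close> in \<open>S\<close>; but \<open>j\<close> lies
  in every maximal left ideal, in particular in the annihilator of \<open>f m\<close>.\<close>

lemma jacobson_radical_annihilates: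
  assumes sp: "star_prime R M" and S: "simple_submodule R M S"
    and j: "j \<in> jacobson_radical R" and m: "m \<in> carrier M"
  shows "j \<odot>\<^bsub>M\<^esub> m = \<zero>\<^bsub>M\<^esub>"
proof (rule ccontr)
  assume ne: "j \<odot>\<^bsub>M\<^esub> m \<noteq> \<zero>\<^bsub>M\<^esub>"
  have jR: "j \<in> carrier R" using j by (simp add: jacobson_radical_def)
  have S': "submodule S R M" "S \<noteq> {\<zero>\<^bsub>M\<^esub>}" using S by (auto simp: simple_submodule_def)
  obtain f where f: "f \<in> module_homs R M M" "f ` carrier M \<subseteq> S" "f (j \<odot>\<^bsub>M\<^esub> m) \<noteq> \<zero>\<^bsub>M\<^esub>"
    using star_prime_hom_elem[OF sp S' _ ne] jR m by blast
  have jf: "j \<odot>\<^bsub>M\<^esub> f m \<noteq> \<zero>\<^bsub>M\<^esub>" using f jR m by (simp add: hom_smult)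
  then have "f m \<noteq> \<zero>\<^bsub>M\<^esub>" using jR by auto
  moreover have "f m \<in> S" using f m by blast
  ultimately have "maximal_left_ideal R {r \<in> carrier R. r \<odot>\<^bsub>M\<^esub> f m = \<zero>\<^bsub>M\<^esub>}"
    using maximal_left_ideal_annihilator[OF S] by blast
  then have "j \<in> {r \<in> carrier R. r \<odot>\<^bsub>M\<^esub> f m = \<zero>\<^bsub>M\<^esub>}"
    using j by (auto simp: jacobson_radical_def)
  then show False using jf by simp
qed

section \<open>Modules annihilated by the kernel of a semisimple quotient\<close>

text \<open>For fixed \<open>m\<close>, sending the coset of \<open>a\<close> to \<open>a m\<close>
  is well defined because \<open>J\<close> kills \<open>M\<close>. It carries simple left ideals of
  the quotient to zero or simple submodules of \<open>M\<close>, so the coset of 1, which lies in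
  the socle of the quotient, shows that \<open>m\<close> lies in the socle of
  \<open>M\<close>.\<close>

lemma socle_eq_carrier_if_semisimple_quotient:
  assumes ss: "semisimple_artinian (R Quot J)" and J: "J \<subseteq> carrier R" "\<zero> \<in> J"
    and ann: "\<And>j x. j \<in> J \<Longrightarrow> x \<in> carrier M \<Longrightarrow> j \<odot>\<^bsub>M\<^esub> x = \<zero>\<^bsub>M\<^esub>"
  shows "socle R M = carrier M"
proof
  show "socle R M \<subseteq> carrier M" using submodule_socle by (auto simp: submodule_iff)
  show "carrier M \<subseteq> socle R M"
  proof
    fix m assume m: "m \<in> carrier M"
    let ?Q = "R Quot J"
    interpret Q: ring ?Q using ss by (simp add: semisimple_artinian_def)
    let ?QQ = "regular_module ?Q"
    interpret QQ: left_module ?Q ?QQ by (rule Q.left_module_regular)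
    have subQ: "submodule H ?Q ?QQ \<longleftrightarrow> H \<subseteq> carrier ?Q \<and> J \<in> H \<and>
        (\<forall>X\<in>H. \<forall>Y\<in>H. X <+>\<^bsub>R\<^esub> Y \<in> H) \<and> (\<forall>Z\<in>carrier ?Q. \<forall>X\<in>H. rcoset_mult R J Z X \<in> H)" for H
      by (simp add: QQ.submodule_iff) (simp add: regular_module_def FactRing_def)
    have carQ: "X \<in> carrier ?Q \<longleftrightarrow> (\<exists>a\<in>carrier R. X = J +> a)" for X
      by (auto simp: FactRing_def A_RCOSETS_def')
    have coset_mem: "r \<in> J +> a \<longleftrightarrow> (\<exists>j\<in>J. r = j \<oplus> a)" for r a
      by (auto simp: a_r_coset_def')
    \<comment> \<open>Well-definedness: every representative of a coset acts on \<open>m\<close> in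
      the same way.\<close>
    have coset: "r \<in> carrier R" "r \<odot>\<^bsub>M\<^esub> m = a \<odot>\<^bsub>M\<^esub> m" if "r \<in> J +> a" "a \<in> carrier R" for r a
      using that J m ann by (auto simp: coset_mem smult_l_distr subset_iff)
    have self: "a \<in> J +> a" if "a \<in> carrier R" for a
      using that J by (auto simp: coset_mem intro!: bexI[of _ \<zero>])
    have QR: "r \<in> carrier R" if "X \<in> carrier ?Q" "r \<in> X" for X r
      using that coset by (auto simp: carQ)
    have QE: "r \<odot>\<^bsub>M\<^esub> m = r' \<odot>\<^bsub>M\<^esub> m" if "X \<in> carrier ?Q" "r \<in> X" "r' \<in> X" for X r r'
      using that coset by (auto simp: carQ)
    \<comment> \<open>The preimage of \<open>K\<close> under the map from cosets to
      \<open>R m\<close>.\<close>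
    define V where "V K = {X \<in> carrier ?Q. \<forall>r\<in>X. r \<odot>\<^bsub>M\<^esub> m \<in> K}" for K
    have V: "submodule (V K) ?Q ?QQ" if K: "submodule K R M" for K
      unfolding subQ
    proof (intro conjI ballI)
      show "V K \<subseteq> carrier ?Q" by (auto simp: V_def)
      have "J \<in> carrier ?Q" using Q.zero_closed by (simp add: FactRing_def)
      then show "J \<in> V K" using K m ann by (auto simp: V_def submodule_iff)
      fix X assume X: "X \<in> V K"
      then have XQ: "X \<in> carrier ?Q" by (simp add: V_def)
      {
        fix Y assume Y: "Y \<in> V K"
        then have YQ: "Y \<in> carrier ?Q" by (simp add: V_def)
        have "X <+>\<^bsub>R\<^esub> Y \<in> carrier ?Q" using Q.a_closed[OF XQ YQ] by (simp add: FactRing_def)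
        moreover have "r \<odot>\<^bsub>M\<^esub> m \<in> K" if r: "r \<in> X <+>\<^bsub>R\<^esub> Y" for r
        proof -
          obtain x y where xy: "x \<in> X" "y \<in> Y" "r = x \<oplus> y" using r by (auto simp: set_add_def')
          then have "r \<odot>\<^bsub>M\<^esub> m = x \<odot>\<^bsub>M\<^esub> m \<oplus>\<^bsub>M\<^esub> y \<odot>\<^bsub>M\<^esub> m"
            using QR[OF XQ] QR[OF YQ] m by (simp add: smult_l_distr)
          then show ?thesis using xy X Y K by (auto simp: V_def submodule_iff)
        qed
        ultimately show "X <+>\<^bsub>R\<^esub> Y \<in> V K" by (simp add: V_def)
      }
      fix Z assume Z: "Z \<in> carrier ?Q"
      have "rcoset_mult R J Z X \<in> carrier ?Q"
        using Q.m_closed[OF Z XQ] by (simp add: FactRing_def)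
      moreover have "r \<odot>\<^bsub>M\<^esub> m \<in> K" if r: "r \<in> rcoset_mult R J Z X" for r
      proof -
        obtain z x where zx: "z \<in> Z" "x \<in> X" "r \<in> J +> (z \<otimes> x)"
          using r by (auto simp: rcoset_mult_def)
        have c: "z \<in> carrier R" "x \<in> carrier R" using zx QR Z XQ by blast+
        then have "r \<odot>\<^bsub>M\<^esub> m = z \<odot>\<^bsub>M\<^esub> (x \<odot>\<^bsub>M\<^esub> m)"
          using coset(2)[OF zx(3)] m by (simp add: smult_assoc1)
        then show ?thesis using zx c X K by (auto simp: V_def submodule_iff)
      qed
      ultimately show "rcoset_mult R J Z X \<in> V K" by (simp add: V_def)
    qed
    have "L \<subseteq> V (socle R M)" if L: "simple_submodule ?Q ?QQ L" for L
    proof -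
      have Lsub: "submodule L ?Q ?QQ" using L by (simp add: simple_submodule_def)
      then have LQ: "\<And>X. X \<in> L \<Longrightarrow> X \<in> carrier ?Q" by (auto simp: subQ)
      \<comment> \<open>The image \<open>L m\<close> of the simple left ideal
        \<open>L\<close>.\<close>
      define E where "E = {r \<odot>\<^bsub>M\<^esub> m | r. r \<in> \<Union>L}"
      have E: "submodule E R M"
        unfolding submodule_iff
      proof (intro conjI ballI)
        show "E \<subseteq> carrier M" using QR LQ m by (auto simp: E_def)
        have "\<zero> \<in> \<Union>L" using Lsub J by (auto simp: subQ)
        then show "\<zero>\<^bsub>M\<^esub> \<in> E" unfolding E_def using smult_l_zero[OF m] by force
        fix u assume "u \<in> E"
        then obtain x X where x: "u = x \<odot>\<^bsub>M\<^esub> m" "x \<in> X" "X \<in> L" by (auto simp: E_def)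
        {
          fix v assume "v \<in> E"
          then obtain y Y where y: "v = y \<odot>\<^bsub>M\<^esub> m" "y \<in> Y" "Y \<in> L" by (auto simp: E_def)
          have "x \<oplus> y \<in> X <+>\<^bsub>R\<^esub> Y" "X <+>\<^bsub>R\<^esub> Y \<in> L" using x y Lsub by (auto simp: subQ set_add_def')
          moreover have "u \<oplus>\<^bsub>M\<^esub> v = (x \<oplus> y) \<odot>\<^bsub>M\<^esub> m"
            using x y QR LQ m by (metis smult_l_distr)
          ultimately show "u \<oplus>\<^bsub>M\<^esub> v \<in> E" by (auto simp: E_def)
        }
        fix r assume r: "r \<in> carrier R"
        have xR: "x \<in> carrier R" using x QR LQ by blast
        have "J +> r \<in> carrier ?Q" using r carQ by blast
        then have "rcoset_mult R J (J +> r) X \<in> L" using x Lsub by (auto simp: subQ)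
        moreover have "r \<otimes> x \<in> rcoset_mult R J (J +> r) X"
          using self[OF r] self[of "r \<otimes> x"] x r xR by (auto simp: rcoset_mult_def)
        moreover have "r \<odot>\<^bsub>M\<^esub> u = (r \<otimes> x) \<odot>\<^bsub>M\<^esub> m" using x r xR m by (simp add: smult_assoc1)
        ultimately show "r \<odot>\<^bsub>M\<^esub> u \<in> E" by (auto simp: E_def)
      qed
      have "K = {\<zero>\<^bsub>M\<^esub>} \<or> K = E" if K: "submodule K R M" "K \<subseteq> E" for K
      proof -
        \<comment> \<open>Simplicity of \<open>L\<close> is transferred to \<open>E\<close> by
          pulling \<open>K\<close> back to a submodule of \<open>L\<close>.\<close>
        have "L \<inter> V K = {\<zero>\<^bsub>?QQ\<^esub>} \<or> L \<inter> V K = L"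
          using L QQ.submodule_Int[OF Lsub V[OF K(1)]] unfolding simple_submodule_def by blast
        then show ?thesis
        proof
          assume "L \<inter> V K = L"
          then have "E \<subseteq> K" unfolding E_def V_def by blast
          then show ?thesis using K by blast
        next
          assume "L \<inter> V K = {\<zero>\<^bsub>?QQ\<^esub>}"
          then have LV: "L \<inter> V K = {J}" by (simp add: regular_module_def FactRing_def)
          have "k = \<zero>\<^bsub>M\<^esub>" if k: "k \<in> K" for k
          proof -
            have "k \<in> E" using k K by blast
            then obtain r X where r: "k = r \<odot>\<^bsub>M\<^esub> m" "r \<in> X" "X \<in> L"
              unfolding E_def by blast
            \<comment> \<open>One representative of \<open>X\<close> sends \<open>m\<close> into
              \<open>K\<close>, so all do. Hence \<open>X\<close> lies in
              \<open>L \<inter> V K\<close>, which makes \<open>X\<close> the zero coset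
              \<open>J\<close>, whose elements kill \<open>m\<close>.\<close>
            have "r' \<odot>\<^bsub>M\<^esub> m \<in> K" if "r' \<in> X" for r'
              using QE[OF LQ[OF r(3)] that r(2)] k r(1) by simp
            then have "X \<in> V K" using LQ[OF r(3)] by (simp add: V_def)
            then have "r \<in> J" using LV r by blast
            then show ?thesis using r ann m by simp
          qed
          then show ?thesis using K by (auto simp: submodule_iff)
        qed
      qed
      then have "E \<subseteq> {\<zero>\<^bsub>M\<^esub>} \<or> simple_submodule R M E"
        using E unfolding simple_submodule_def by blast
      moreover have "\<zero>\<^bsub>M\<^esub> \<in> socle R M" using submodule_socle by (simp add: submodule_iff)
      ultimately have "E \<subseteq> socle R M" using simple_subset_socle by blast
      then show ?thesis using LQ unfolding V_def E_def by blast
    qed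
    then have "socle ?Q ?QQ \<subseteq> V (socle R M)"
      by (intro QQ.socle_least V submodule_socle)
    then have "J +> \<one> \<in> V (socle R M)" using ss carQ by (auto simp: semisimple_artinian_def)
    then have "\<one> \<odot>\<^bsub>M\<^esub> m \<in> socle R M" using self[of \<one>] by (simp add: V_def)
    then show "m \<in> socle R M" using m by simp
  qed
qed

end

theorem mainTheorem9:
  fixes R :: "('a, 'r) ring_scheme" and M :: "('a, 'b, 'm) module_scheme"
  assumes "prime_ring R"
    and "semilocal R \<or> left_qfd R"
    and "left_module R M"
    and "faithful_module R M"
    and "star_prime R M"
    and "socle R M \<noteq> {\<zero>\<^bsub>M\<^esub>}"
  shows "prime_ring (endo_ring R M)"
proof -
  interpret left_module R M by fact
  \<comment> \<open>Without simple submodules the socle would be an empty sum, hence zero.\<close>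
  have "\<exists>S. simple_submodule R M S"
  proof (rule ccontr)
    assume "\<nexists>S. simple_submodule R M S"
    then have "socle R M \<subseteq> {\<zero>\<^bsub>M\<^esub>}" using socle_least[OF submodule_zero] by blast
    then show False using assms(6) submodule_socle by (auto simp: submodule_iff)
  qed
  then obtain S where S: "simple_submodule R M S" by blast
  then have nz: "carrier M \<noteq> {\<zero>\<^bsub>M\<^esub>}"
    by (auto simp: simple_submodule_def submodule_iff)
  have "socle R M = carrier M"
    using assms(2)
  proof
    assume "semilocal R"
    then show ?thesis
      using socle_eq_carrier_if_semisimple_quotient[of "jacobson_radical R"]
        jacobson_radical_annihilates[OF assms(5) S] zero_in_jacobson_radical
      by (auto simp: semilocal_def jacobson_radical_def)
  next
    assume "left_qfd R"
    then show ?thesis using socle_eq_carrier_if_qfd assms(5) S by blast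
  qed
  then show ?thesis using prime_endo_ring_if_socle_eq assms(5) nz by blast
qed

end
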